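(* Let $m,n$ be nonnegative integers with $(m,n)\neq(0,1)$ and $m+n\geq 1$, and let $k\geq 3$. Let $\mathcal{A}_k$ be the family of simple graphs with acyclic chromatic number at most $k$. Then $\chi_{(m,n)}(\mathcal{A}_k)=k(2m+n)^{k-1}$.
   Context: An $(m,n)$-colored mixed graph $G=(V,A\cup E)$ consists of a vertex set $V$, a set $A$ of arcs each colored with one of $m$ colors $\alpha_1,\dots,\alpha_m$, and a set $E$ of edges each colored with one of $n$ colors $\beta_1,\dots,\beta_n$, such that the underlying undirected graph (forgetting orientations and colors) is simple (each pair of vertices joined by at most one arc or edge, no loops). A colored homomorphism of $G=(V_1,A_1\cup E_1)$ to $H=(V_2,A_2\cup E_2)$ is a map $f:V_1\to V_2$ such that every arc $uv$ of $G$ is mapped to an arc $f(u)f(v)$ of $H$ of the same color and every edge $uv$ of $G$ is mapped to an edge $f(u)f(v)$ of $H$ of the same color. The $(m,n)$-colored mixed chromatic number $\chi_{(m,n)}(G)$ of an $(m,n)$-colored mixed graph $G$ is the minimum number of vertices of an $(m,n)$-colored mixed graph $H$ such that $G$ admits a colored homomorphism to $H$. For a simple undirected graph $G$, $\chi_{(m,n)}(G)$ is the maximum of $\chi_{(m,n)}(G')$ over all $(m,n)$-colored mixed graphs $G'$ whose underlying graph is $G$; for a family $\mathcal{F}$ of simple graphs, $\chi_{(m,n)}(\mathcal{F})$ is the supremum of $\chi_{(m,n)}(G)$ over $G\in\mathcal{F}$. A graph is $k$-acyclic colorable if its vertices can be properly colored with $k$ colors such that any two color classes induce a forest; the acyclic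 chromatic number is the least such $k$. *)

theory Defs
  imports Main "HOL-Library.Extended_Nat"
begin

section \<open>Simple graphs and acyclic colorings\<close>

record 'a sgraph =
  verts :: "'a set"
  edges :: "'a set set"

definition simple_graph :: "'a sgraph \<Rightarrow> bool" where
  "simple_graph G \<longleftrightarrow> (\<forall>e\<in>edges G. e \<subseteq> verts G \<and> card e = 2)"

definition induced_subgraph :: "'a sgraph \<Rightarrow> 'a set \<Rightarrow> 'a sgraph" where
  "induced_subgraph G S = \<lparr>verts = verts G \<inter> S, edges = {e \<in> edges G. e \<subseteq> S}\<rparr>"

definition is_cycle :: "'a sgraph \<Rightarrow> 'a list \<Rightarrow> bool" where
  "is_cycle G xs \<longleftrightarrow> length xs \<ge> 3 \<and> distinct xs \<and>
     (\<forall>i<length xs. {xs ! i, xs ! (Suc i mod length xs)} \<in> edges G)"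

definition forest :: "'a sgraph \<Rightarrow> bool" where
  "forest G \<longleftrightarrow> (\<nexists>xs. is_cycle G xs)"

definition proper_coloring :: "'a sgraph \<Rightarrow> nat \<Rightarrow> ('a \<Rightarrow> nat) \<Rightarrow> bool" where
  "proper_coloring G k c \<longleftrightarrow> (\<forall>v\<in>verts G. c v < k) \<and>
     (\<forall>u v. {u, v} \<in> edges G \<longrightarrow> c u \<noteq> c v)"

definition acyclic_colorable :: "nat \<Rightarrow> 'a sgraph \<Rightarrow> bool" where
  "acyclic_colorable k G \<longleftrightarrow> (\<exists>c. proper_coloring G k c \<and>
     (\<forall>i<k. \<forall>j<k. i \<noteq> j \<longrightarrow>
        forest (induced_subgraph G {v \<in> verts G. c v = i \<or> c v = j})))"

text \<open>Infima in \<^typ>\<open>enat\<close> are minima, and the infimum of the empty set is \<open>\<infinity>\<close>.\<close>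

definition acyclic_chromatic_number :: "'a sgraph \<Rightarrow> enat" where
  "acyclic_chromatic_number G = Inf {enat k | k. acyclic_colorable k G}"

definition acyclic_family :: "nat \<Rightarrow> 'a sgraph set" where
  "acyclic_family k = {G. simple_graph G \<and> acyclic_chromatic_number G \<le> enat k}"


section \<open>Colored mixed graphs\<close>

text \<open>The arc colors are \<open>0, \<dots>, m - 1\<close> and the edge colors are \<open>0, \<dots>, n - 1\<close>. The values of
  \<open>acol\<close> and \<open>ecol\<close> outside the sets of arcs and edges carry no meaning.\<close>

record 'a mixed_graph =
  mverts :: "'a set"
  marcs :: "('a \<times> 'a) set"
  medges :: "'a set set"
  acol :: "'a \<times> 'a \<Rightarrow> nat"
  ecol :: "'a set \<Rightarrow> nat"

definition underlying_graph :: "'a mixed_graph \<Rightarrow> 'a sgraph" where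
  "underlying_graph G =
     \<lparr>verts = mverts G, edges = {{u, v} | u v. (u, v) \<in> marcs G} \<union> medges G\<rparr>"

text \<open>The underlying graph is a set of edges, so parallel arcs and edges have to be excluded
  separately.\<close>

definition colored_mixed_graph :: "nat \<Rightarrow> nat \<Rightarrow> 'a mixed_graph \<Rightarrow> bool" where
  "colored_mixed_graph m n G \<longleftrightarrow>
     simple_graph (underlying_graph G) \<and>
     (\<forall>u v. (u, v) \<in> marcs G \<longrightarrow> (v, u) \<notin> marcs G \<and> {u, v} \<notin> medges G) \<and>
     (\<forall>a\<in>marcs G. acol G a < m) \<and>
     (\<forall>e\<in>medges G. ecol G e < n)"

definition colored_hom :: "'a mixed_graph \<Rightarrow> 'b mixed_graph \<Rightarrow> ('a \<Rightarrow> 'b) \<Rightarrow> bool" where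
  "colored_hom G H f \<longleftrightarrow>
     (\<forall>v\<in>mverts G. f v \<in> mverts H) \<and>
     (\<forall>u v. (u, v) \<in> marcs G \<longrightarrow>
        (f u, f v) \<in> marcs H \<and> acol H (f u, f v) = acol G (u, v)) \<and>
     (\<forall>u v. {u, v} \<in> medges G \<longrightarrow>
        {f u, f v} \<in> medges H \<and> ecol H {f u, f v} = ecol G {u, v})"

text \<open>Every finite target graph is isomorphic to one with vertices in \<^typ>\<open>nat\<close>; the value is
  \<open>\<infinity>\<close> if there is no finite target.\<close>

definition mixed_chromatic_number :: "nat \<Rightarrow> nat \<Rightarrow> 'a mixed_graph \<Rightarrow> enat" where
  "mixed_chromatic_number m n G =
     Inf {enat (card (mverts H)) | H :: nat mixed_graph.
            colored_mixed_graph m n H \<and> finite (mverts H) \<and> (\<exists>f. colored_hom G H f)}"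

definition graph_mixed_chromatic_number :: "nat \<Rightarrow> nat \<Rightarrow> 'a sgraph \<Rightarrow> enat" where
  "graph_mixed_chromatic_number m n G =
     Sup {mixed_chromatic_number m n G' | G'.
            colored_mixed_graph m n G' \<and> underlying_graph G' = G}"

definition family_mixed_chromatic_number :: "nat \<Rightarrow> nat \<Rightarrow> 'a sgraph set \<Rightarrow> enat" where
  "family_mixed_chromatic_number m n F = (SUP G\<in>F. graph_mixed_chromatic_number m n G)"

end

theory Submission imports Defs "HOL-Library.FuncSet" begin

text \<open>Let \<open>p = 2 * m + n\<close> be the number of ways in which an ordered pair of vertices can be joined.

  Upper bound: fix an acyclic \<open>k\<close>-coloring. Two color classes \<open>i < j\<close> induce a forest, on which every
  antisymmetric weight is a potential difference; so there are labels in \<open>\<int>/p\<close> such that the type of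
  every adjacent pair between the two classes is the difference of its labels. Mapping a vertex to
  its color and its \<open>k - 1\<close> labels is a homomorphism to a graph with \<open>k * p ^ (k - 1)\<close> vertices.

  Lower bound: take one root of each color. For every color \<open>c\<close> and every choice of types, add a vertex
  of color \<open>c\<close> joined in that way to the roots of the other colors; those of the same color have
  distinct images, as they are distinguished by the image of some root. For any two of them with
  different colors, add a vertex of a third color joined to them with different types, which forces
  their images apart; here \<open>k \<ge> 3\<close> and \<open>p \<ge> 2\<close> are needed. Every vertex has at most one earlier
  neighbor in each color class, so the coloring is acyclic.\<close>

section \<open>Potentials on forests\<close>

fun walk_sum :: "('a \<Rightarrow> 'a \<Rightarrow> int) \<Rightarrow> 'a list \<Rightarrow> int" where
  "walk_sum s (x # y # xs) = s x y + walk_sum s (y # xs)"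
| "walk_sum s xs = 0"

abbreviation walk :: "'a sgraph \<Rightarrow> 'a list \<Rightarrow> bool" where
  "walk G \<equiv> successively (\<lambda>u v. {u, v} \<in> edges G)"

lemma walk_sum_split: "walk_sum s (xs @ a # ys) = walk_sum s (xs @ [a]) + walk_sum s (a # ys)"
proof (induction xs)
  case (Cons x xs)
  then show ?case by (cases xs) auto
qed auto

lemma walk_rev: "walk G (rev xs) \<longleftrightarrow> walk G xs"
  by (simp add: successively_rev insert_commute)

lemma walk_sum_rev:
  assumes "\<And>u v. {u, v} \<in> edges G \<Longrightarrow> s v u = - s u v" and "walk G xs"
  shows "walk_sum s (rev xs) = - walk_sum s xs"
  using assms(2)
proof (induction xs)
  case (Cons x xs)
  show ?case
  proof (cases xs)
    case (Cons y ys)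
    have "walk_sum s (rev (x # xs)) = walk_sum s (rev xs) + walk_sum s [y, x]"
      using walk_sum_split[of s "rev ys" y "[x]"] Cons by simp
    also have "\<dots> = - walk_sum s (x # xs)"
      using Cons.IH Cons.prems Cons assms(1)[of x y] by auto
    finally show ?thesis .
  qed simp
qed simp

text \<open>Induction on the length. A vertex repeated before the end splits the walk into two
  shorter closed walks. Otherwise the walk is a single vertex, an impossible loop, a step back and
  forth, which cancels by antisymmetry, or a cycle, which a forest excludes.\<close>

lemma closed_walk_sum_eq_0:
  assumes simple: "\<And>e. e \<in> edges G \<Longrightarrow> card e = 2" and "forest G"
    and anti: "\<And>u v. {u, v} \<in> edges G \<Longrightarrow> s v u = - s u v"
    and "walk G xs" "xs \<noteq> []" "hd xs = last xs"
  shows "walk_sum s xs = 0"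
  using assms(4-)
proof (induction xs rule: length_induct)
  case (1 xs)
  \<comment> \<open>Dropping the last vertex, which equals the first, leaves the cyclic vertex
    sequence that \<open>is_cycle\<close> expects.\<close>
  define ys where "ys = butlast xs"
  have xs: "xs = ys @ [last xs]" using 1 by (simp add: ys_def)
  show ?case
  proof (cases "distinct ys")
    case dist: True
    consider "ys = []" | a where "ys = [a]" | a b where "ys = [a, b]" | "length ys \<ge> 3"
      by (cases ys rule: remdups_adj.cases) (auto simp: Suc_le_eq numeral_3_eq_3)
    then show ?thesis
    proof cases
      case 1
      then show ?thesis by (subst xs) simp
    next
      case (2 a)
      then have "xs = [a, a]" using xs "1.prems" by (metis append_Cons append_Nil list.sel(1))
      then have "{a, a} \<in> edges G" using "1.prems" by simp
      then show ?thesis using simple by fastforce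
    next
      case (3 a b)
      then have "xs = [a, b, a]" using xs "1.prems" by (metis append_Cons append_Nil list.sel(1))
      then show ?thesis using "1.prems" anti[of a b] by simp
    next
      case 4
      have l: "length xs = Suc (length ys)" by (subst xs) simp
      have "{ys ! i, ys ! (Suc i mod length ys)} \<in> edges G" if i: "i < length ys" for i
      proof -
        have "{xs ! i, xs ! Suc i} \<in> edges G"
          using "1.prems"(1) i l by (simp add: successively_conv_nth)
        moreover have "xs ! i = ys ! i" using i by (subst xs) (simp add: nth_append)
        moreover have "xs ! Suc i = ys ! (Suc i mod length ys)"
        proof (cases "Suc i = length ys")
          case True
          have "xs ! Suc i = last xs" using True by (subst xs) (simp add: nth_append)
          also have "\<dots> = ys ! 0" using "1.prems" 4 by (metis (no_types) xs hd_append2 hd_conv_nth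
                list.size(3) not_numeral_le_zero)
          finally show ?thesis using True by simp
        next
          case False
          then show ?thesis using i by (subst xs) (simp add: nth_append)
        qed
        ultimately show ?thesis by simp
      qed
      then have "is_cycle G ys" using 4 dist by (simp add: is_cycle_def)
      then show ?thesis using \<open>forest G\<close> by (auto simp: forest_def)
    qed
  next
    case False
    then obtain as a bs cs where ys: "ys = as @ [a] @ bs @ [a] @ cs"
      using not_distinct_decomp by metis
    have xs': "xs = as @ a # bs @ a # cs @ [last xs]" using xs ys by simp
    \<comment> \<open>\<open>?p\<close> is the closed walk between two visits to \<open>a\<close>,
      and \<open>?q\<close> is what remains after cutting it out. Both are shorter than
      \<open>xs\<close>.\<close>
    let ?p = "a # bs @ [a]" and ?q = "as @ a # cs @ [last xs]"
    have w: "walk G (as @ a # bs @ a # cs @ [last xs])" using "1.prems"(1) xs' by simp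
    have wp: "walk G ?p" and wq: "walk G ?q"
      using w by (auto simp: successively_append_iff successively_Cons hd_append split: if_splits)
    have len: "length xs = length as + length bs + length cs + 3" by (subst xs') simp
    have "hd ?q = last ?q"
    proof -
      have "hd ?q = hd (as @ a # bs @ a # cs @ [last xs])" by (cases as) auto
      then show ?thesis using "1.prems"(3) xs' by simp
    qed
    then have q: "walk_sum s ?q = 0" using "1.IH" wq len by auto
    have p: "walk_sum s ?p = 0" using "1.IH" wp len by auto
    have "walk_sum s xs = walk_sum s (as @ [a]) + walk_sum s ((a # bs) @ a # cs @ [last xs])"
      by (subst xs', subst walk_sum_split) simp
    also have "walk_sum s ((a # bs) @ a # cs @ [last xs]) =
        walk_sum s ?p + walk_sum s (a # cs @ [last xs])"
      by (subst walk_sum_split) simp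
    finally show ?thesis using p q walk_sum_split[of s as a "cs @ [last xs]"] by simp
  qed
qed

definition walk_betw :: "'a sgraph \<Rightarrow> 'a \<Rightarrow> 'a list \<Rightarrow> 'a \<Rightarrow> bool" where
  "walk_betw G u xs v \<longleftrightarrow> xs \<noteq> [] \<and> walk G xs \<and> hd xs = u \<and> last xs = v"

lemma walk_betw_rev: "walk_betw G u xs v \<Longrightarrow> walk_betw G v (rev xs) u"
  by (simp add: walk_betw_def walk_rev hd_rev last_rev del: successively_rev)

lemma walk_betw_snoc:
  "walk_betw G u xs v \<Longrightarrow> {v, w} \<in> edges G \<Longrightarrow> walk_betw G u (xs @ [w]) w"
  by (auto simp: walk_betw_def successively_append_iff)

lemma walk_betw_join:
  assumes "walk_betw G u xs v" "walk_betw G v ys w"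
  shows "walk_betw G u (xs @ tl ys) w"
    and "walk_sum s (xs @ tl ys) = walk_sum s xs + walk_sum s ys"
proof -
  from assms(2) obtain zs where ys: "ys = v # zs" by (cases ys) (auto simp: walk_betw_def)
  from assms(1) obtain us where xs: "xs = us @ [v]"
    by (cases xs rule: rev_cases) (auto simp: walk_betw_def)
  show "walk_betw G u (xs @ tl ys) w"
    using assms unfolding xs ys
    by (cases zs) (auto simp: walk_betw_def successively_append_iff hd_append)
  show "walk_sum s (xs @ tl ys) = walk_sum s xs + walk_sum s ys"
    using walk_sum_split[of s us v zs] xs ys by simp
qed

text \<open>The potential of a vertex is the sum of \<open>s\<close> along a chosen walk from a root
  of its component. As closed walks have sum zero, the choice of the walk does not matter.\<close>

lemma forest_potential:
  fixes s :: "'a \<Rightarrow> 'a \<Rightarrow> int"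
  assumes simple: "\<And>e. e \<in> edges G \<Longrightarrow> card e = 2" and "forest G"
    and anti: "\<And>u v. {u, v} \<in> edges G \<Longrightarrow> s v u = - s u v"
  obtains z :: "'a \<Rightarrow> int" where "\<And>u v. {u, v} \<in> edges G \<Longrightarrow> z v - z u = s u v"
proof -
  define conn where "conn = (\<lambda>u v. \<exists>xs. walk_betw G u xs v)"
  define root where "root = (\<lambda>v. SOME r. conn v r)"
  define path where "path = (\<lambda>v. SOME xs. walk_betw G (root v) xs v)"
  define z where "z = (\<lambda>v. walk_sum s (path v))"
  have conn_sym: "conn v u" if "conn u v" for u v
    using that walk_betw_rev unfolding conn_def by metis
  have conn_trans: "conn u w" if "conn u v" "conn v w" for u v w
    using that walk_betw_join(1) unfolding conn_def by metis
  have conn_refl: "conn v v" for v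
    unfolding conn_def by (rule exI[of _ "[v]"]) (simp add: walk_betw_def)
  have "conn v (root v)" for v
    unfolding root_def by (rule someI, rule conn_refl)
  then have path: "walk_betw G (root v) (path v) v" for v
    unfolding path_def using conn_sym by (metis conn_def someI_ex)
  have "z v - z u = s u v" if e: "{u, v} \<in> edges G" for u v
  proof -
    have "walk_betw G u [u, v] v" using e by (simp add: walk_betw_def)
    then have "conn u v" unfolding conn_def by blast
    \<comment> \<open>Equality of the whole predicates makes the choice operator pick the same root
      for both ends.\<close>
    then have "conn u = conn v" using conn_sym conn_trans by blast
    then have root: "root u = root v" by (simp add: root_def)
    have wu: "walk_betw G (root v) (path u @ [v]) v"
      using walk_betw_snoc[OF path[of u] e] root by simp
    have wv: "walk_betw G v (rev (path v)) (root v)"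
      using walk_betw_rev[OF path] .
    obtain us where us: "path u = us @ [u]"
      using path[of u] by (cases "path u" rule: rev_cases) (auto simp: walk_betw_def)
    \<comment> \<open>This closed walk runs from the common root to \<open>u\<close>, along the edge
      to \<open>v\<close>, and back along \<open>path v\<close>.\<close>
    have "walk_sum s ((path u @ [v]) @ tl (rev (path v))) = 0"
      using walk_betw_join(1)[OF wu wv] closed_walk_sum_eq_0[OF simple \<open>forest G\<close> anti]
      by (auto simp: walk_betw_def)
    moreover have "walk_sum s (path u @ [v]) = z u + s u v"
      using walk_sum_split[of s us u "[v]"] us by (simp add: z_def)
    moreover have "walk_sum s (rev (path v)) = - z v"
      using walk_sum_rev[of G s, OF anti] path[of v] by (simp add: walk_betw_def z_def)
    ultimately show ?thesis using walk_betw_join(2)[OF wu wv, of s] by simp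
  qed
  then show thesis by (rule that)
qed


section \<open>Adjacency types\<close>

text \<open>The ordered pair of ends of an arc or edge has one of \<open>2 * m + n\<close> types: outgoing arcs of
  color \<open>a\<close> have type \<open>a\<close>, incoming ones \<open>m + a\<close>, and edges of color \<open>b\<close> have type \<open>2 * m + b\<close>.\<close>

definition flip :: "nat \<Rightarrow> nat \<Rightarrow> nat" where
  "flip m t = (if t < m then t + m else if t < 2 * m then t - m else t)"

lemma flip_flip [simp]: "flip m (flip m t) = t"
  by (auto simp: flip_def)

lemma flip_less: "t < 2 * m + n \<Longrightarrow> flip m t < 2 * m + n"
  by (auto simp: flip_def)

text \<open>In a colored mixed graph at most one of the first three cases applies, so the order of
  the tests does not matter there.\<close>

definition adj_type :: "nat \<Rightarrow> 'a mixed_graph \<Rightarrow> 'a \<Rightarrow> 'a \<Rightarrow> nat option" where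
  "adj_type m G u v =
     (if (u, v) \<in> marcs G then Some (acol G (u, v))
      else if (v, u) \<in> marcs G then Some (m + acol G (v, u))
      else if {u, v} \<in> medges G then Some (2 * m + ecol G {u, v})
      else None)"

lemma colored_mixed_graphD:
  assumes "colored_mixed_graph m n G"
  shows "(u, v) \<in> marcs G \<Longrightarrow> (v, u) \<notin> marcs G"
    and "(u, v) \<in> marcs G \<Longrightarrow> {u, v} \<notin> medges G"
    and "(u, v) \<in> marcs G \<Longrightarrow> {v, u} \<notin> medges G"
    and "(u, v) \<in> marcs G \<Longrightarrow> acol G (u, v) < m"
    and "e \<in> medges G \<Longrightarrow> ecol G e < n"
  using assms unfolding colored_mixed_graph_def by (metis insert_commute)+

lemma adj_type_flip:
  assumes "colored_mixed_graph m n G"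
  shows "adj_type m G v u = map_option (flip m) (adj_type m G u v)"
  using colored_mixed_graphD(1-4)[OF assms, of u v] colored_mixed_graphD(1-4)[OF assms, of v u]
  by (auto simp: adj_type_def flip_def insert_commute)

lemma adj_type_less:
  assumes "colored_mixed_graph m n G" "adj_type m G u v = Some t"
  shows "t < 2 * m + n"
  using assms(2) colored_mixed_graphD(4,5)[OF assms(1)]
  by (fastforce simp: adj_type_def split: if_splits)

lemma underlying_edge_iff:
  "{u, v} \<in> edges (underlying_graph G) \<longleftrightarrow> adj_type m G u v \<noteq> None"
  by (auto simp: underlying_graph_def adj_type_def doubleton_eq_iff)

lemma adj_type_marcs:
  assumes "colored_mixed_graph m n G"
  shows "(u, v) \<in> marcs G \<and> acol G (u, v) = a \<longleftrightarrow> a < m \<and> adj_type m G u v = Some a"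
  using colored_mixed_graphD(1-4)[OF assms, of u v]
  by (auto simp: adj_type_def)

lemma adj_type_medges:
  assumes "colored_mixed_graph m n G"
  shows "{u, v} \<in> medges G \<and> ecol G {u, v} = b \<longleftrightarrow> adj_type m G u v = Some (2 * m + b)"
  using colored_mixed_graphD(1-4)[OF assms, of u v] colored_mixed_graphD(1-4)[OF assms, of v u]
  by (auto simp: adj_type_def)

text \<open>Arcs in both directions and edges are merged into a single condition on types. An
  incoming arc is handled by reversing the pair, which acts on the types of both graphs by the same
  \<open>flip\<close>.\<close>

lemma colored_hom_iff_adj_type:
  assumes G: "colored_mixed_graph m n G" and H: "colored_mixed_graph m n H"
  shows "colored_hom G H f \<longleftrightarrow> (\<forall>v\<in>mverts G. f v \<in> mverts H) \<and>
    (\<forall>u v t. adj_type m G u v = Some t \<longrightarrow> adj_type m H (f u) (f v) = Some t)"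
    (is "?L \<longleftrightarrow> ?V \<and> ?R")
proof
  assume hom: ?L
  have "adj_type m H (f u) (f v) = Some t" if t: "adj_type m G u v = Some t" for u v t
  proof -
    consider "(u, v) \<in> marcs G" | "(v, u) \<in> marcs G" | "{u, v} \<in> medges G"
      using t by (auto simp: adj_type_def split: if_splits)
    then show ?thesis
    proof cases
      case 1
      then show ?thesis using hom t by (auto simp: colored_hom_def adj_type_def)
    next
      case 2
      then have "adj_type m H (f v) (f u) = adj_type m G v u"
        using hom by (auto simp: colored_hom_def adj_type_def)
      then show ?thesis using adj_type_flip[OF G] adj_type_flip[OF H] t by metis
    next
      case 3
      then have "{f u, f v} \<in> medges H \<and> ecol H {f u, f v} = ecol G {u, v}"
        using hom by (auto simp: colored_hom_def)
      then show ?thesis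
        using 3 t adj_type_medges[OF G, of u v] adj_type_medges[OF H, of "f u" "f v"] by metis
    qed
  qed
  then show "?V \<and> ?R" using hom by (auto simp: colored_hom_def)
next
  assume R: "?V \<and> ?R"
  show ?L
    unfolding colored_hom_def
  proof (intro conjI allI impI)
    show "\<forall>v\<in>mverts G. f v \<in> mverts H" using R by blast
  next
    fix u v assume "(u, v) \<in> marcs G"
    then show "(f u, f v) \<in> marcs H" "acol H (f u, f v) = acol G (u, v)"
      using adj_type_marcs[OF G, of u v] adj_type_marcs[OF H, of "f u" "f v"] R by metis+
  next
    fix u v assume "{u, v} \<in> medges G"
    then show "{f u, f v} \<in> medges H" "ecol H {f u, f v} = ecol G {u, v}"
      using adj_type_medges[OF G, of u v] adj_type_medges[OF H, of "f u" "f v"] R by metis+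
  qed
qed

section \<open>Colored mixed graphs with prescribed types\<close>

definition typed_graph :: "nat \<Rightarrow> 'a set \<Rightarrow> ('a \<Rightarrow> 'a \<Rightarrow> nat option) \<Rightarrow> 'a mixed_graph" where
  "typed_graph m V \<tau> =
     \<lparr>mverts = V,
      marcs = {(u, v). u \<in> V \<and> v \<in> V \<and> (\<exists>t<m. \<tau> u v = Some t)},
      medges = {{u, v} | u v. u \<in> V \<and> v \<in> V \<and> (\<exists>t\<ge>2 * m. \<tau> u v = Some t)},
      acol = (\<lambda>(u, v). the (\<tau> u v)),
      ecol = (\<lambda>e. (SOME t. \<exists>u v. e = {u, v} \<and> \<tau> u v = Some t) - 2 * m)\<rparr>"

text \<open>These are properties that \<open>adj_type\<close> has on every colored mixed graph.
  Conversely, they suffice for \<open>typed_graph\<close> to be such a graph with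
  \<open>\<tau>\<close> as its type function on \<open>V\<close>.\<close>

locale type_function =
  fixes m n :: nat and V :: "'a set" and \<tau> :: "'a \<Rightarrow> 'a \<Rightarrow> nat option"
  assumes flip: "u \<in> V \<Longrightarrow> v \<in> V \<Longrightarrow> \<tau> v u = map_option (flip m) (\<tau> u v)"
    and irrefl: "u \<in> V \<Longrightarrow> \<tau> u u = None"
    and bounded: "u \<in> V \<Longrightarrow> v \<in> V \<Longrightarrow> \<tau> u v = Some t \<Longrightarrow> t < 2 * m + n"
begin

lemma medges_iff:
  "{u, v} \<in> medges (typed_graph m V \<tau>) \<longleftrightarrow> u \<in> V \<and> v \<in> V \<and> (\<exists>t\<ge>2 * m. \<tau> u v = Some t)"
proof -
  have "\<exists>t\<ge>2 * m. \<tau> v u = Some t" if "u \<in> V" "v \<in> V" "t \<ge> 2 * m" "\<tau> u v = Some t" for u v t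
    using that flip[of u v] by (auto simp: flip_def)
  then show ?thesis by (fastforce simp: typed_graph_def doubleton_eq_iff)
qed

text \<open>As \<open>flip\<close> fixes every type from \<open>2 * m\<close> on, both orders of the
  ends give the same type, and the choice in the definition of \<open>ecol\<close> has only one
  candidate.\<close>

lemma ecol_eq:
  assumes "u \<in> V" "v \<in> V" "t \<ge> 2 * m" "\<tau> u v = Some t"
  shows "ecol (typed_graph m V \<tau>) {u, v} = t - 2 * m"
proof -
  have "\<tau> v u = Some t" using assms flip[of u v] by (auto simp: flip_def)
  then have "(SOME t'. \<exists>x y. {u, v} = {x, y} \<and> \<tau> x y = Some t') = t"
    using assms by (intro some_equality) (auto simp: doubleton_eq_iff)
  then show ?thesis by (simp add: typed_graph_def)
qed

lemma colored_mixed_graph_typed_graph: "colored_mixed_graph m n (typed_graph m V \<tau>)"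
proof -
  let ?G = "typed_graph m V \<tau>"
  have arcs: "(u, v) \<in> marcs ?G \<longleftrightarrow> u \<in> V \<and> v \<in> V \<and> (\<exists>t<m. \<tau> u v = Some t)" for u v
    by (simp add: typed_graph_def)
  have "e \<subseteq> V \<and> card e = 2" if e: "e \<in> edges (underlying_graph ?G)" for e
  proof -
    obtain u v where "e = {u, v}" "u \<in> V" "v \<in> V" "\<tau> u v \<noteq> None"
      using e by (fastforce simp: underlying_graph_def typed_graph_def)
    moreover from this have "u \<noteq> v" using irrefl by auto
    ultimately show ?thesis by auto
  qed
  then have "simple_graph (underlying_graph ?G)"
    by (simp add: simple_graph_def underlying_graph_def typed_graph_def)
  moreover have "(v, u) \<notin> marcs ?G \<and> {u, v} \<notin> medges ?G" if "(u, v) \<in> marcs ?G" for u v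
    using that flip[of u v] unfolding arcs medges_iff by (auto simp: flip_def)
  moreover have "\<forall>a\<in>marcs ?G. acol ?G a < m"
    by (auto simp: typed_graph_def)
  moreover have "ecol ?G e < n" if e: "e \<in> medges ?G" for e
  proof -
    obtain u v t where "e = {u, v}" "u \<in> V" "v \<in> V" "t \<ge> 2 * m" "\<tau> u v = Some t"
      using e by (auto simp: typed_graph_def)
    then show ?thesis using ecol_eq[of u v t] bounded[of u v t] by simp
  qed
  ultimately show ?thesis unfolding colored_mixed_graph_def by blast
qed

lemma adj_type_typed_graph:
  "adj_type m (typed_graph m V \<tau>) u v = (if u \<in> V \<and> v \<in> V then \<tau> u v else None)"
proof -
  let ?G = "typed_graph m V \<tau>"
  have arcs: "(u, v) \<in> marcs ?G \<longleftrightarrow> u \<in> V \<and> v \<in> V \<and> (\<exists>t<m. \<tau> u v = Some t)" for u v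
    by (simp add: typed_graph_def)
  have acol: "acol ?G (u, v) = the (\<tau> u v)" for u v by (simp add: typed_graph_def)
  show ?thesis
  proof (cases "u \<in> V \<and> v \<in> V")
    case V: True
    show ?thesis
    proof (cases "\<tau> u v")
      case None
      then show ?thesis using V flip[of u v] by (simp add: adj_type_def arcs medges_iff)
    next
      case (Some t)
      then have vu: "\<tau> v u = Some (flip m t)" using V flip[of u v] by simp
      consider "t < m" | "m \<le> t" "t < 2 * m" | "2 * m \<le> t" by linarith
      then show ?thesis
      proof cases
        case 1
        then show ?thesis using V Some by (simp add: adj_type_def arcs acol)
      next
        \<comment> \<open>The arc is stored as \<open>(v, u)\<close> with color
          \<open>t - m\<close>, and \<open>adj_type\<close> adds \<open>m\<close> again.\<close>
        case 2
        then show ?thesis using V Some vu by (simp add: adj_type_def arcs acol flip_def)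
      next
        case 3
        then show ?thesis using V Some vu ecol_eq[of u v t]
          by (simp add: adj_type_def arcs medges_iff flip_def)
      qed
    qed
  qed (auto simp: adj_type_def arcs medges_iff)
qed

end


section \<open>The upper bound\<close>

text \<open>A label is a color with one residue modulo \<open>p\<close> for each other color;
  extensionality identifies functions that agree on the other colors, so that the count is exact. In
  the lower bound the same set indexes the \<open>Full\<close> vertices, with the residues read as
  types.\<close>

definition label_set :: "nat \<Rightarrow> nat \<Rightarrow> (nat \<times> (nat \<Rightarrow> nat)) set" where
  "label_set k p = (SIGMA i:{..<k}. PiE ({..<k} - {i}) (\<lambda>_. {..<p}))"

lemma finite_label_set: "finite (label_set k p)"
  by (auto simp: label_set_def intro!: finite_SigmaI finite_PiE)

lemma card_label_set: "card (label_set k p) = k * p ^ (k - 1)"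
  by (simp add: label_set_def card_SigmaI finite_PiE card_PiE)

lemma label_setD:
  assumes "x \<in> label_set k p"
  shows "fst x < k" and "snd x \<in> PiE ({..<k} - {fst x}) (\<lambda>_. {..<p})"
    and "j < k \<Longrightarrow> j \<noteq> fst x \<Longrightarrow> snd x j < p"
proof -
  have "(fst x, snd x) \<in> (SIGMA i:{..<k}. PiE ({..<k} - {i}) (\<lambda>_. {..<p}))"
    using assms by (simp only: label_set_def prod.collapse)
  then have x: "fst x \<in> {..<k}" "snd x \<in> PiE ({..<k} - {fst x}) (\<lambda>_. {..<p})"
    by (rule SigmaD1, rule SigmaD2)
  then show "fst x < k" "snd x \<in> PiE ({..<k} - {fst x}) (\<lambda>_. {..<p})" by simp_all
  show "snd x j < p" if "j < k" "j \<noteq> fst x"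
    using PiE_mem[OF x(2), of j] that by simp
qed

text \<open>Two labels are compared through the entry that each has for the color of the other. The
  difference is taken from the lower to the higher color and then reversed by \<open>flip\<close>,
  because negation modulo \<open>p\<close> is in general not the reversal of types.\<close>

definition label_type :: "nat \<Rightarrow> nat \<Rightarrow> nat \<times> (nat \<Rightarrow> nat) \<Rightarrow> nat \<times> (nat \<Rightarrow> nat) \<Rightarrow> nat option"
  where "label_type m p = (\<lambda>(i, x) (j, y).
     if i < j then Some (nat ((int (y i) - int (x j)) mod int p))
     else if j < i then Some (flip m (nat ((int (x j) - int (y i)) mod int p)))
     else None)"

lemma label_type_flip: "label_type m p y x = map_option (flip m) (label_type m p x y)"
  by (cases x; cases y) (auto simp: label_type_def)

text \<open>The map \<open>g\<close> lets the vertices be numbers, as the targets in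
  \<open>mixed_chromatic_number\<close> are, while the types are computed on labels.\<close>

lemma type_function_label_type:
  assumes "2 * m + n > 0"
  shows "type_function m n V (\<lambda>a b. label_type m (2 * m + n) (g a) (g b))"
proof
  fix u v t assume t: "label_type m (2 * m + n) (g u) (g v) = Some t"
  have "nat (a mod int (2 * m + n)) < 2 * m + n" for a
    using assms by (subst nat_less_iff) (auto intro: pos_mod_sign pos_mod_bound)
  then show "t < 2 * m + n"
    using t flip_less[of _ m n] by (auto simp: label_type_def split: prod.splits if_splits)
next
  show "label_type m (2 * m + n) (g v) (g u) =
      map_option (flip m) (label_type m (2 * m + n) (g u) (g v))" for u v
    by (rule label_type_flip)
next
  show "label_type m (2 * m + n) (g u) (g u) = None" for u
    by (simp add: label_type_def split: prod.splits)
qed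

text \<open>Only the direction from class \<open>i\<close> to class \<open>j\<close> is weighted by
  its type; the opposite direction gets the negative, not the flipped type. This makes the weight
  antisymmetric, so that it has a potential on the forest.\<close>

lemma bicolored_potential:
  assumes G: "colored_mixed_graph m n G"
    and c: "proper_coloring (underlying_graph G) k c"
    and forest: "forest (induced_subgraph (underlying_graph G) {v \<in> mverts G. c v = i \<or> c v = j})"
    and "i \<noteq> j"
  shows "\<exists>z :: 'a \<Rightarrow> int. \<forall>u v t. c u = i \<longrightarrow> c v = j \<longrightarrow> adj_type m G u v = Some t \<longrightarrow>
    z v - z u = int t"
proof -
  let ?U = "underlying_graph G"
  let ?F = "induced_subgraph ?U {v \<in> mverts G. c v = i \<or> c v = j}"
  define s where "s u v = (if c u = i then int (the (adj_type m G u v))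
    else - int (the (adj_type m G v u)))" for u v
  have simple: "simple_graph ?U" using G by (simp add: colored_mixed_graph_def)
  have card: "card e = 2" if "e \<in> edges ?F" for e
    using that simple by (simp add: induced_subgraph_def simple_graph_def)
  have anti: "s v u = - s u v" if e: "{u, v} \<in> edges ?F" for u v
  proof -
    have "c u \<noteq> c v" "c u = i \<or> c u = j" "c v = i \<or> c v = j"
      using e c by (auto simp: induced_subgraph_def proper_coloring_def)
    then show ?thesis using \<open>i \<noteq> j\<close> by (auto simp: s_def)
  qed
  obtain z where z: "\<And>u v. {u, v} \<in> edges ?F \<Longrightarrow> z v - z u = s u v"
    using forest_potential[of ?F s, OF card forest anti] by blast
  have "z v - z u = int t" if t: "c u = i" "c v = j" "adj_type m G u v = Some t" for u v t
  proof -
    have e: "{u, v} \<in> edges ?U" using t underlying_edge_iff[of u v G m] by simp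
    then have "{u, v} \<subseteq> verts ?U" using simple unfolding simple_graph_def by blast
    then have "{u, v} \<in> edges ?F"
      using e t by (auto simp: induced_subgraph_def underlying_graph_def)
    then show ?thesis using z t by (simp add: s_def)
  qed
  then show ?thesis by blast
qed

lemma mixed_chromatic_number_le:
  assumes G: "colored_mixed_graph m n G" and "2 * m + n > 0"
    and "acyclic_colorable k (underlying_graph G)"
  shows "mixed_chromatic_number m n G \<le> enat (k * (2 * m + n) ^ (k - 1))"
proof -
  define p where "p = 2 * m + n"
  define L where "L = label_set k p"
  let ?U = "underlying_graph G"
  obtain c where c: "proper_coloring ?U k c"
    and forest: "\<And>i j. i < k \<Longrightarrow> j < k \<Longrightarrow> i \<noteq> j \<Longrightarrow>
      forest (induced_subgraph ?U {v \<in> mverts G. c v = i \<or> c v = j})"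
    using assms(3) by (auto simp: acyclic_colorable_def underlying_graph_def)
  define good where "good i j z \<longleftrightarrow> (\<forall>u v t. c u = i \<longrightarrow> c v = j \<longrightarrow> adj_type m G u v = Some t
    \<longrightarrow> z v - z u = int t)" for i j and z :: "'a \<Rightarrow> int"
  define Z where "Z i j = (SOME z. good i j z)" for i j
  have Z: "good i j (Z i j)" if "i < k" "j < k" "i \<noteq> j" for i j
  proof -
    have "\<exists>z. good i j z"
      unfolding good_def by (rule bicolored_potential[OF G c forest[OF that] that(3)])
    then show ?thesis unfolding Z_def by (rule someI_ex)
  qed
  \<comment> \<open>Both ends of an edge must read the same potential, so \<open>Z\<close> takes the
    smaller color first. \<open>restrict\<close> puts the second component into the function space
    of \<open>label_set\<close>.\<close>
  define f where "f u = (c u, restrict (\<lambda>j. nat ((if c u < j then Z (c u) j u else Z j (c u) u)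
    mod int p)) ({..<k} - {c u}))" for u
  have p: "p > 0" using assms(2) by (simp add: p_def)
  have verts: "u \<in> mverts G" "v \<in> mverts G" if "adj_type m G u v = Some t" for u v t
  proof -
    have "{u, v} \<in> edges ?U" using that underlying_edge_iff[of u v G m] by simp
    moreover have "simple_graph ?U" using G by (simp add: colored_mixed_graph_def)
    ultimately have "{u, v} \<subseteq> verts ?U" unfolding simple_graph_def by blast
    then show "u \<in> mverts G" "v \<in> mverts G" by (auto simp: underlying_graph_def)
  qed
  have ck: "c u < k" if "u \<in> mverts G" for u
    using that c by (simp add: proper_coloring_def underlying_graph_def)
  have fL: "f u \<in> L" if "u \<in> mverts G" for u
    using ck[OF that] p by (auto simp: f_def L_def label_set_def nat_less_iff)
  have less: "label_type m p (f u) (f v) = Some t"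
    if t: "adj_type m G u v = Some t" and "c u < c v" for u v t
  proof -
    have k: "c u < k" "c v < k" using verts[OF t] ck by auto
    then have z: "Z (c u) (c v) v - Z (c u) (c v) u = int t"
      using Z[of "c u" "c v"] t \<open>c u < c v\<close> by (simp add: good_def)
    \<comment> \<open>Being less than \<open>p\<close>, the type is determined by its
      residue.\<close>
    have "t < p" using adj_type_less[OF G t] by (simp add: p_def)
    then have "nat ((Z (c u) (c v) v mod int p - Z (c u) (c v) u mod int p) mod int p) = t"
      by (simp add: mod_diff_eq z)
    then show ?thesis using k p \<open>c u < c v\<close> by (simp add: f_def label_type_def)
  qed
  have type: "label_type m p (f u) (f v) = Some t" if t: "adj_type m G u v = Some t" for u v t
  proof -
    have "{u, v} \<in> edges ?U" using t underlying_edge_iff[of u v G m] by simp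
    then consider "c u < c v" | "c v < c u"
      using c unfolding proper_coloring_def by (meson linorder_neqE_nat)
    then show ?thesis
    proof cases
      case 2
      have "adj_type m G v u = Some (flip m t)" using adj_type_flip[OF G, of v u] t by simp
      then have "label_type m p (f v) (f u) = Some (flip m t)" using less 2 by blast
      then show ?thesis using label_type_flip[of m p "f u" "f v"] by simp
    qed (use less t in blast)
  qed
  obtain b where b: "bij_betw b L {0..<card L}"
    using ex_bij_betw_finite_nat finite_label_set unfolding L_def by blast
  define g where "g = inv_into L b"
  have gb: "g (b x) = x" if "x \<in> L" for x
    using that b by (simp add: g_def bij_betw_def)
  interpret type_function m n "{0..<card L}" "\<lambda>x y. label_type m p (g x) (g y)"
    unfolding p_def by (rule type_function_label_type[OF assms(2)])
  let ?H = "typed_graph m {0..<card L} (\<lambda>x y. label_type m p (g x) (g y))"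
  have bL: "b x \<in> {0..<card L}" if "x \<in> L" for x
    using b that by (auto simp: bij_betw_def)
  have H: "mverts ?H = {0..<card L}" by (simp add: typed_graph_def)
  have "colored_hom G ?H (\<lambda>v. b (f v))"
    unfolding colored_hom_iff_adj_type[OF G colored_mixed_graph_typed_graph]
  proof (intro conjI ballI allI impI)
    fix v assume "v \<in> mverts G"
    then show "b (f v) \<in> mverts ?H" using bL fL H by blast
  next
    fix u v t assume t: "adj_type m G u v = Some t"
    have "f u \<in> L" "f v \<in> L" using verts[OF t] fL by auto
    then show "adj_type m ?H (b (f u)) (b (f v)) = Some t"
      using bL type[OF t] gb by (simp add: adj_type_typed_graph)
  qed
  then have "mixed_chromatic_number m n G \<le> enat (card (mverts ?H))"
    unfolding mixed_chromatic_number_def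
    using colored_mixed_graph_typed_graph H
    by (intro Inf_lower CollectI exI[of _ ?H] conjI) auto
  then show ?thesis using H by (simp add: L_def card_label_set p_def)
qed

text \<open>The same coloring serves. A color of at least \<open>k\<close> occurs at no vertex, so a
  pair containing one leaves at most one color class, where properness allows no edge and hence no
  cycle.\<close>

lemma acyclic_colorable_mono:
  assumes "acyclic_colorable k G" "k \<le> l"
  shows "acyclic_colorable l G"
proof -
  obtain c where c: "proper_coloring G k c"
    and forest: "\<And>i j. i < k \<Longrightarrow> j < k \<Longrightarrow> i \<noteq> j \<Longrightarrow>
      forest (induced_subgraph G {v \<in> verts G. c v = i \<or> c v = j})"
    using assms(1) unfolding acyclic_colorable_def by blast
  have "forest (induced_subgraph G {v \<in> verts G. c v = i \<or> c v = j})" if "i \<noteq> j" for i j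
  proof (cases "i < k \<and> j < k")
    case False
    have "\<not> is_cycle (induced_subgraph G {v \<in> verts G. c v = i \<or> c v = j}) xs" for xs
    proof
      assume cyc: "is_cycle (induced_subgraph G {v \<in> verts G. c v = i \<or> c v = j}) xs"
      let ?y = "xs ! (Suc 0 mod length xs)"
      from cyc have "0 < length xs" by (auto simp: is_cycle_def)
      then have "{xs ! 0, ?y} \<in> edges (induced_subgraph G {v \<in> verts G. c v = i \<or> c v = j})"
        using cyc unfolding is_cycle_def by blast
      then have "{xs ! 0, ?y} \<in> edges G" "xs ! 0 \<in> verts G" "?y \<in> verts G"
        "c (xs ! 0) = i \<or> c (xs ! 0) = j" "c ?y = i \<or> c ?y = j"
        by (auto simp: induced_subgraph_def)
      then show False using c False unfolding proper_coloring_def by metis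
    qed
    then show ?thesis by (simp add: forest_def)
  qed (use forest that in blast)
  moreover have "proper_coloring G l c" using c assms(2) by (auto simp: proper_coloring_def)
  ultimately show ?thesis unfolding acyclic_colorable_def by blast
qed

text \<open>A finite bound forces the set of admissible numbers to be nonempty. Its infimum is then
  attained, and monotonicity leads from there to \<open>k\<close>.\<close>

lemma acyclic_chromatic_number_le_iff:
  "acyclic_chromatic_number G \<le> enat k \<longleftrightarrow> acyclic_colorable k G"
proof
  let ?A = "{enat j | j. acyclic_colorable j G}"
  assume le: "acyclic_chromatic_number G \<le> enat k"
  then have "?A \<noteq> {}"
    unfolding acyclic_chromatic_number_def by (metis Inf_empty enat_ord_code(5) top_enat_def)
  then have "Inf ?A \<in> ?A" unfolding Inf_enat_def by (metis (no_types, lifting) LeastI_ex ex_in_conv)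
  then show "acyclic_colorable k G"
    using le acyclic_colorable_mono unfolding acyclic_chromatic_number_def by auto
next
  assume "acyclic_colorable k G"
  then show "acyclic_chromatic_number G \<le> enat k"
    unfolding acyclic_chromatic_number_def by (intro Inf_lower) blast
qed


section \<open>The lower bound\<close>

text \<open>A vertex of highest level on a bicolored cycle has two distinct neighbors on the cycle,
  both of lower level and both of the other color, contrary to \<open>unique\<close>.\<close>

lemma acyclic_colorable_if_levels:
  fixes level :: "'a \<Rightarrow> nat"
  assumes c: "proper_coloring G k c"
    and level: "\<And>u v. {u, v} \<in> edges G \<Longrightarrow> level u \<noteq> level v"
    and unique: "\<And>u v w. {v, u} \<in> edges G \<Longrightarrow> {v, w} \<in> edges G \<Longrightarrow> level u < level v \<Longrightarrow>
      level w < level v \<Longrightarrow> c u = c w \<Longrightarrow> u = w"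
  shows "acyclic_colorable k G"
proof -
  have "\<not> is_cycle (induced_subgraph G {v \<in> verts G. c v = i \<or> c v = j}) xs" for i j xs
  proof
    let ?F = "induced_subgraph G {v \<in> verts G. c v = i \<or> c v = j}"
    let ?l = "length xs"
    assume cyc: "is_cycle ?F xs"
    then have l: "?l \<ge> 3" and dist: "distinct xs" by (auto simp: is_cycle_def)
    have edge: "{xs ! a, xs ! (Suc a mod ?l)} \<in> edges ?F" if "a < ?l" for a
      using cyc that by (simp add: is_cycle_def)
    have "\<exists>a<?l. \<forall>b<?l. level (xs ! b) \<le> level (xs ! a)"
    proof -
      let ?S = "(\<lambda>a. level (xs ! a)) ` {..<?l}"
      have ne: "?S \<noteq> {}" using l by (auto simp: lessThan_empty_iff)
      then have "Max ?S \<in> ?S" by (intro Max_in) auto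
      then obtain a where "a < ?l" "level (xs ! a) = Max ?S" by auto
      then show ?thesis using Max_ge[of ?S] by auto
    qed
    then obtain a where a: "a < ?l" and max: "\<And>b. b < ?l \<Longrightarrow> level (xs ! b) \<le> level (xs ! a)"
      by blast
    \<comment> \<open>\<open>a'\<close> and \<open>?b\<close> are the cyclic predecessor and
      successor of position \<open>a\<close>; they differ because the cycle has at least three
      vertices.\<close>
    define a' where "a' = (if a = 0 then ?l - 1 else a - 1)"
    have a': "a' < ?l" "Suc a' mod ?l = a" using a l by (auto simp: a'_def)
    let ?b = "Suc a mod ?l"
    have b: "?b < ?l" using l by (intro mod_less_divisor) linarith
    have "?b \<noteq> a'" using l a by (cases "Suc a = ?l") (auto simp: a'_def)
    then have neq: "xs ! ?b \<noteq> xs ! a'" using dist b a' by (simp add: nth_eq_iff_index_eq)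
    have e: "{xs ! a, xs ! ?b} \<in> edges ?F" "{xs ! a, xs ! a'} \<in> edges ?F"
      using edge[OF a] edge[OF a'(1)] a'(2) by (simp_all add: insert_commute)
    then have eG: "{xs ! a, xs ! ?b} \<in> edges G" "{xs ! a, xs ! a'} \<in> edges G"
      by (auto simp: induced_subgraph_def)
    have "level (xs ! ?b) < level (xs ! a)" "level (xs ! a') < level (xs ! a)"
      using level[OF eG(1)] level[OF eG(2)] max[OF b] max[OF a'(1)] by linarith+
    moreover have "c (xs ! ?b) = c (xs ! a')"
    proof -
      have "c (xs ! a) \<noteq> c (xs ! ?b)" "c (xs ! a) \<noteq> c (xs ! a')"
        using c eG by (auto simp: proper_coloring_def)
      moreover have "\<And>x. x \<in> {xs ! a, xs ! ?b, xs ! a'} \<Longrightarrow> c x = i \<or> c x = j"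
        using e by (auto simp: induced_subgraph_def)
      ultimately show ?thesis by (metis insertCI)
    qed
    ultimately show False using unique[OF eG] neq by blast
  qed
  then show ?thesis using c unfolding acyclic_colorable_def forest_def by blast
qed

section \<open>The extremal graph\<close>

datatype gadget_vertex =
  Root nat
| Full "nat \<times> (nat \<Rightarrow> nat)"
| Sep "nat \<times> (nat \<Rightarrow> nat)" "nat \<times> (nat \<Rightarrow> nat)"

text \<open>Each adjacency is recorded once, from the higher to the lower level. The index of a
  \<open>Full\<close> vertex holds its color and its types towards the roots of the other colors.
  \<open>Sep x y\<close> tells \<open>x\<close> and \<open>y\<close> apart by the types 0 and 1,
  which are available when \<open>p \<ge> 2\<close>.\<close>

fun up_type :: "gadget_vertex \<Rightarrow> gadget_vertex \<Rightarrow> nat option" where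
  "up_type (Full x) (Root j) = (if j = fst x then None else Some (snd x j))"
| "up_type (Sep x y) (Full w) = (if w = x then Some 0 else if w = y then Some 1 else None)"
| "up_type _ _ = None"

fun gadget_level :: "gadget_vertex \<Rightarrow> nat" where
  "gadget_level (Root i) = 0"
| "gadget_level (Full x) = 1"
| "gadget_level (Sep x y) = 2"

fun gadget_color :: "gadget_vertex \<Rightarrow> nat" where
  "gadget_color (Root i) = i"
| "gadget_color (Full x) = fst x"
| "gadget_color (Sep x y) = (LEAST d. d \<noteq> fst x \<and> d \<noteq> fst y)"

text \<open>Levels drop along \<open>up_type\<close>, so it is defined in at most one direction and
  the two branches never compete.\<close>

definition gadget_type :: "nat \<Rightarrow> gadget_vertex \<Rightarrow> gadget_vertex \<Rightarrow> nat option" where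
  "gadget_type m v w = (case up_type v w of Some t \<Rightarrow> Some t
     | None \<Rightarrow> map_option (flip m) (up_type w v))"

text \<open>For distinct indices of one color, a \<open>Sep\<close> vertex would have two lower
  neighbors in one class; these indices are separated by a root instead.\<close>

definition gadget_verts :: "nat \<Rightarrow> nat \<Rightarrow> gadget_vertex set" where
  "gadget_verts k p = Root ` {..<k} \<union> Full ` label_set k p \<union>
     (\<lambda>(x, y). Sep x y) ` {(x, y) \<in> label_set k p \<times> label_set k p. fst x \<noteq> fst y}"

lemma gadget_verts_iff [simp]:
  "Root i \<in> gadget_verts k p \<longleftrightarrow> i < k"
  "Full x \<in> gadget_verts k p \<longleftrightarrow> x \<in> label_set k p"
  "Sep x y \<in> gadget_verts k p \<longleftrightarrow> x \<in> label_set k p \<and> y \<in> label_set k p \<and> fst x \<noteq> fst y"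
  by (auto simp: gadget_verts_def)

lemma finite_gadget_verts: "finite (gadget_verts k p)"
proof -
  have "finite {(x, y) \<in> label_set k p \<times> label_set k p. fst x \<noteq> fst y}"
    by (rule finite_subset[of _ "label_set k p \<times> label_set k p"])
      (auto simp: finite_label_set)
  then show ?thesis by (simp add: gadget_verts_def finite_label_set)
qed

lemma up_type_level: "up_type v w = Some t \<Longrightarrow> gadget_level w < gadget_level v"
  by (cases "(v, w)" rule: up_type.cases) auto

lemma up_type_asym: "up_type v w = Some t \<Longrightarrow> up_type w v = None"
  using up_type_level[of v w] up_type_level[of w v] by (cases "up_type w v") auto

text \<open>Of the colors 0, 1, 2 at most two are excluded. Hence the color of a \<open>Sep\<close>
  vertex stays below \<open>k\<close> as soon as \<open>k \<ge> 3\<close>.\<close>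

lemma Least_third_color: "(LEAST d. d \<noteq> a \<and> d \<noteq> b) < 3"
  "(LEAST d. d \<noteq> a \<and> d \<noteq> b) \<noteq> a" "(LEAST d. d \<noteq> a \<and> d \<noteq> b) \<noteq> b" for a b :: nat
proof -
  obtain d where d: "d < 3" "d \<noteq> a \<and> d \<noteq> b"
  proof (cases "0 \<noteq> a \<and> 0 \<noteq> b")
    case False
    then show ?thesis
      by (cases "1 \<noteq> a \<and> 1 \<noteq> b") (auto intro: that[of 1] that[of 2])
  qed (auto intro: that[of 0])
  then show "(LEAST d. d \<noteq> a \<and> d \<noteq> b) < 3" using Least_le[of "\<lambda>d. d \<noteq> a \<and> d \<noteq> b" d] by linarith
  show "(LEAST d. d \<noteq> a \<and> d \<noteq> b) \<noteq> a" "(LEAST d. d \<noteq> a \<and> d \<noteq> b) \<noteq> b"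
    using LeastI[of "\<lambda>d. d \<noteq> a \<and> d \<noteq> b", OF d(2)] by auto
qed

lemma up_type_color: "up_type v w = Some t \<Longrightarrow> gadget_color v \<noteq> gadget_color w"
  by (cases "(v, w)" rule: up_type.cases) (auto simp: Least_third_color split: if_splits)

text \<open>The lower neighbors of a \<open>Full\<close> vertex are roots, one per color; those of a
  \<open>Sep\<close> vertex are two \<open>Full\<close> vertices, whose colors differ by the choice
  of \<open>gadget_verts\<close>.\<close>

lemma up_type_unique:
  assumes "v \<in> gadget_verts k p" "up_type v u = Some s" "up_type v w = Some t"
    "gadget_color u = gadget_color w"
  shows "u = w"
  using assms
  by (cases "(v, u)" rule: up_type.cases; cases "(v, w)" rule: up_type.cases)
    (auto split: if_splits)

lemma up_type_less:
  assumes "v \<in> gadget_verts k p" "w \<in> gadget_verts k p" "p \<ge> 2" "up_type v w = Some t"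
  shows "t < p"
  using assms
  by (cases "(v, w)" rule: up_type.cases)
    (auto dest: label_setD(3)[of "(_, _)", simplified] split: if_splits)

lemma gadget_color_less: "v \<in> gadget_verts k p \<Longrightarrow> k \<ge> 3 \<Longrightarrow> gadget_color v < k"
proof (cases v)
  case (Sep x y)
  then show "gadget_color v < k" if "k \<ge> 3"
    using Least_third_color(1)[of "fst x" "fst y"] that by simp
qed (auto dest: label_setD(1))

lemma gadget_type_neq_None_iff:
  "gadget_type m v w \<noteq> None \<longleftrightarrow> up_type v w \<noteq> None \<or> up_type w v \<noteq> None"
  by (auto simp: gadget_type_def split: option.splits)

lemma type_function_gadget_type:
  assumes "g ` V \<subseteq> gadget_verts k (2 * m + n)" "2 * m + n \<ge> 2"
  shows "type_function m n V (\<lambda>a b. gadget_type m (g a) (g b))"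
proof
  fix u v
  show "gadget_type m (g v) (g u) = map_option (flip m) (gadget_type m (g u) (g v))"
    using up_type_asym[of "g u" "g v"]
    by (cases "up_type (g u) (g v)"; cases "up_type (g v) (g u)") (auto simp: gadget_type_def)
next
  fix u
  show "gadget_type m (g u) (g u) = None"
    using up_type_asym[of "g u" "g u"]
    by (cases "up_type (g u) (g u)") (auto simp: gadget_type_def)
next
  fix u v t assume "u \<in> V" "v \<in> V" and t: "gadget_type m (g u) (g v) = Some t"
  then have V: "g u \<in> gadget_verts k (2 * m + n)" "g v \<in> gadget_verts k (2 * m + n)"
    using assms(1) by auto
  show "t < 2 * m + n"
  proof (cases "up_type (g u) (g v)")
    case None
    then obtain t' where "up_type (g v) (g u) = Some t'" "t = flip m t'"
      using t by (auto simp: gadget_type_def)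
    then show ?thesis using up_type_less[OF V(2,1) assms(2)] flip_less by blast
  next
    case (Some t')
    then show ?thesis using up_type_less[OF V assms(2)] t by (simp add: gadget_type_def)
  qed
qed

text \<open>The finite gadget is copied into the infinite type \<open>'a\<close>. A homomorphism
  cannot identify two \<open>Full\<close> vertices, and there are as many of these as elements of
  \<open>label_set k p\<close>.\<close>

lemma exists_extremal_graph:
  fixes m n k :: nat
  assumes inf: "infinite (UNIV :: 'a set)" and "2 * m + n \<ge> 2" and k: "k \<ge> 3"
  obtains G :: "'a mixed_graph" where "colored_mixed_graph m n G" "finite (mverts G)"
    "acyclic_colorable k (underlying_graph G)"
    "enat (k * (2 * m + n) ^ (k - 1)) \<le> mixed_chromatic_number m n G"
proof -
  define p where "p = 2 * m + n"
  obtain V :: "'a set" where V: "finite V" "card V = card (gadget_verts k p)"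
    using infinite_arbitrarily_large[OF inf, of "card (gadget_verts k p)"] by blast
  then obtain g where g: "bij_betw g V (gadget_verts k p)"
    using finite_same_card_bij[OF V(1) finite_gadget_verts V(2)] by blast
  then have gV: "g ` V = gadget_verts k p" and inj: "inj_on g V" by (auto simp: bij_betw_def)
  interpret type_function m n V "\<lambda>a b. gadget_type m (g a) (g b)"
    using type_function_gadget_type[of g V k m n] gV assms(2) by (simp add: p_def)
  define G where "G = typed_graph m V (\<lambda>a b. gadget_type m (g a) (g b))"
  have G: "colored_mixed_graph m n G"
    unfolding G_def by (rule colored_mixed_graph_typed_graph)
  have verts: "mverts G = V" by (simp add: G_def typed_graph_def)
  have adj: "adj_type m G u v = gadget_type m (g u) (g v)" if "u \<in> V" "v \<in> V" for u v
    using that by (simp add: G_def adj_type_typed_graph)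
  have edge: "u \<in> V \<and> v \<in> V \<and> (up_type (g u) (g v) \<noteq> None \<or> up_type (g v) (g u) \<noteq> None)"
    if "{u, v} \<in> edges (underlying_graph G)" for u v
    using that unfolding underlying_edge_iff[of u v G m]
    by (auto simp: G_def adj_type_typed_graph gadget_type_neq_None_iff simp del: not_None_eq split: if_splits)
  have "proper_coloring (underlying_graph G) k (\<lambda>v. gadget_color (g v))"
    unfolding proper_coloring_def
  proof (intro conjI ballI allI impI)
    fix v assume "v \<in> verts (underlying_graph G)"
    then have "g v \<in> gadget_verts k p" using gV verts by (auto simp: underlying_graph_def)
    then show "gadget_color (g v) < k" using gadget_color_less k by blast
  next
    fix u v assume "{u, v} \<in> edges (underlying_graph G)"
    then show "gadget_color (g u) \<noteq> gadget_color (g v)"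
      using edge[of u v] up_type_color[of "g u" "g v"] up_type_color[of "g v" "g u"] by fastforce
  qed
  then have "acyclic_colorable k (underlying_graph G)"
  proof (rule acyclic_colorable_if_levels[where level = "\<lambda>v. gadget_level (g v)"])
    fix u v assume "{u, v} \<in> edges (underlying_graph G)"
    then show "gadget_level (g u) \<noteq> gadget_level (g v)"
      using edge[of u v] up_type_level[of "g u" "g v"] up_type_level[of "g v" "g u"] by fastforce
  next
    fix u v w
    assume e: "{v, u} \<in> edges (underlying_graph G)" "{v, w} \<in> edges (underlying_graph G)"
      and l: "gadget_level (g u) < gadget_level (g v)" "gadget_level (g w) < gadget_level (g v)"
      and c: "gadget_color (g u) = gadget_color (g w)"
    have "up_type (g v) (g u) \<noteq> None" "up_type (g v) (g w) \<noteq> None"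
      using edge[OF e(1)] edge[OF e(2)] l up_type_level[of "g u" "g v"] up_type_level[of "g w" "g v"]
      by fastforce+
    moreover have "v \<in> V" "u \<in> V" "w \<in> V" using edge[OF e(1)] edge[OF e(2)] by auto
    ultimately have "g u = g w" using up_type_unique[of "g v" k p "g u" _ "g w"] c gV by blast
    then show "u = w" using inj \<open>u \<in> V\<close> \<open>w \<in> V\<close> by (simp add: inj_on_def)
  qed
  moreover have "k * p ^ (k - 1) \<le> card (mverts H)"
    if H: "colored_mixed_graph m n H" "finite (mverts H)" and hom: "colored_hom G H f"
    for H :: "nat mixed_graph" and f
  proof -
    \<comment> \<open>\<open>h\<close> is the homomorphism read on the gadget itself, before copying
      along \<open>g\<close>.\<close>
    define h where "h v = f (inv_into V g v)" for v
    have hV: "h v \<in> mverts H" if "v \<in> gadget_verts k p" for v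
      using that hom verts gV by (auto simp: h_def colored_hom_def intro: inv_into_into)
    have h: "adj_type m H (h v) (h w) = Some t"
      if t: "v \<in> gadget_verts k p" "w \<in> gadget_verts k p" "up_type v w = Some t" for v w t
    proof -
      let ?v = "inv_into V g v" and ?w = "inv_into V g w"
      have "?v \<in> V" "?w \<in> V" "g ?v = v" "g ?w = w"
        using t gV by (auto intro: inv_into_into f_inv_into_f)
      then have "adj_type m G ?v ?w = Some t" using t adj by (simp add: gadget_type_def)
      then show ?thesis using hom colored_hom_iff_adj_type[OF G H(1)] by (simp add: h_def)
    qed
    have "inj_on (\<lambda>x. h (Full x)) (label_set k p)"
    proof (rule inj_onI, rule ccontr)
      fix x y assume x: "x \<in> label_set k p" and y: "y \<in> label_set k p"
        and eq: "h (Full x) = h (Full y)" and "x \<noteq> y"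
      have xy: "Full x \<in> gadget_verts k p" "Full y \<in> gadget_verts k p"
        using x y by simp_all
      show False
      proof (cases "fst x = fst y")
        case True
        then have "snd x \<noteq> snd y" using \<open>x \<noteq> y\<close> by (simp add: prod_eq_iff)
        then obtain j where j: "j \<in> {..<k} - {fst x}" "snd x j \<noteq> snd y j"
          using PiE_ext[OF label_setD(2)[OF x] label_setD(2)[OF y, folded True]] by blast
        \<comment> \<open>If the images agreed, the pair formed with the image of
          \<open>Root j\<close> would have two types in \<open>H\<close>.\<close>
        have "Root j \<in> gadget_verts k p" using j by simp
        then show False using h[OF xy(1), of "Root j"] h[OF xy(2), of "Root j"] j eq True by simp
      next
        case False
        \<comment> \<open>Here \<open>Sep x y\<close> takes the place of the root: its image has
          type 0 towards one image and type 1 towards the other.\<close>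
        then have "Sep x y \<in> gadget_verts k p" using x y by simp
        then show False using h[of "Sep x y", OF _ xy(1)] h[of "Sep x y", OF _ xy(2)] eq \<open>x \<noteq> y\<close> by simp
      qed
    qed
    moreover have "(\<lambda>x. h (Full x)) ` label_set k p \<subseteq> mverts H"
      using hV by auto
    ultimately have "card (label_set k p) \<le> card (mverts H)"
      using H(2) card_inj_on_le by blast
    then show ?thesis by (simp add: card_label_set)
  qed
  then have "enat (k * p ^ (k - 1)) \<le> mixed_chromatic_number m n G"
    unfolding mixed_chromatic_number_def by (intro Inf_greatest) auto
  ultimately show thesis using that G V verts by (simp add: p_def)
qed

text \<open>The upper bound covers the whole family, while the lower bound is witnessed by a finite
  graph, so both suprema are squeezed between the same bounds.\<close>

theorem theorem1:
  fixes m n k :: nat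
  assumes "infinite (UNIV :: 'a set)"
    and "(m, n) \<noteq> (0, 1)" and "m + n \<ge> 1" and "k \<ge> 3"
  shows "family_mixed_chromatic_number m n (acyclic_family k :: 'a sgraph set)
           = enat (k * (2 * m + n) ^ (k - 1)) \<and>
         family_mixed_chromatic_number m n {G \<in> (acyclic_family k :: 'a sgraph set). finite (verts G)}
           = enat (k * (2 * m + n) ^ (k - 1))"
proof -
  let ?N = "enat (k * (2 * m + n) ^ (k - 1))"
  let ?A = "acyclic_family k :: 'a sgraph set"
  \<comment> \<open>Excluding \<open>(0, 0)\<close> and \<open>(0, 1)\<close> means having at least
    two types, as the \<open>Sep\<close> vertices require.\<close>
  have p: "2 * m + n \<ge> 2" using assms(2,3) by (cases m; cases n) auto
  then have pos: "2 * m + n > 0" by linarith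
  have "graph_mixed_chromatic_number m n G \<le> ?N" if "G \<in> ?A" for G
    unfolding graph_mixed_chromatic_number_def
  proof (intro Sup_least, elim CollectE exE conjE)
    fix x and G' :: "'a mixed_graph"
    assume "x = mixed_chromatic_number m n G'" "colored_mixed_graph m n G'"
      "underlying_graph G' = G"
    moreover have "acyclic_colorable k G"
      using that by (simp add: acyclic_family_def acyclic_chromatic_number_le_iff)
    ultimately show "x \<le> ?N"
      using mixed_chromatic_number_le[of m n G' k] pos by blast
  qed
  then have upper: "family_mixed_chromatic_number m n ?A \<le> ?N"
    unfolding family_mixed_chromatic_number_def by (intro SUP_least)
  obtain G :: "'a mixed_graph" where G: "colored_mixed_graph m n G" "finite (mverts G)"
    "acyclic_colorable k (underlying_graph G)" "?N \<le> mixed_chromatic_number m n G"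
    using exists_extremal_graph[OF assms(1) p assms(4)] by blast
  have mem: "underlying_graph G \<in> {G \<in> ?A. finite (verts G)}"
    using G by (simp add: acyclic_family_def acyclic_chromatic_number_le_iff
        colored_mixed_graph_def underlying_graph_def)
  have "?N \<le> mixed_chromatic_number m n G" by (rule G(4))
  also have "\<dots> \<le> graph_mixed_chromatic_number m n (underlying_graph G)"
    unfolding graph_mixed_chromatic_number_def by (intro Sup_upper) (use G in blast)
  also have "\<dots> \<le> family_mixed_chromatic_number m n {G \<in> ?A. finite (verts G)}"
    unfolding family_mixed_chromatic_number_def by (intro SUP_upper mem)
  finally have lower: "?N \<le> family_mixed_chromatic_number m n {G \<in> ?A. finite (verts G)}" .
  have "family_mixed_chromatic_number m n {G \<in> ?A. finite (verts G)}
      \<le> family_mixed_chromatic_number m n ?A"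
    unfolding family_mixed_chromatic_number_def by (intro SUP_subset_mono) auto
  then show ?thesis using upper lower by (auto intro: order.antisym order.trans)
qed

end
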